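(* Let $Y$ be a commutative summation method (satisfying axioms (A), (B), (C)) that assigns a finite real number to the sequence $((-1)^n)_{n\ge 0}=(1,-1,1,-1,\dots)$. Then $Y$ is contradictory.
   Context: Sequences are real sequences $a=(a_0,a_1,a_2,\dots)$. A summation method $Y$ assigns values to some real sequences; formally, treat $Y$ as a relation between real sequences and values, writing $Y(a)=s$ for "$Y$ assigns $s$ to $a$" (uniqueness of the assigned value is the intended requirement on a method, but its failure is exactly what "contradictory" below expresses, so it is not built into the relation). Every method is assumed to satisfy the following axioms, for all real sequences $a,b$ and all real $s,r$ (finite values): (A) for every real $k$: $Y(a)=s$ implies $Y(ka_0,ka_1,ka_2,\dots)=ks$; (B) $Y(a)=s$ and $Y(b)=r$ imply $Y(a_0+b_0,a_1+b_1,a_2+b_2,\dots)=s+r$; (C) $Y(a_0,a_1,a_2,\dots)=s$ if and only if $Y(a_1,a_2,a_3,\dots)=s-a_0$. $Y$ is commutative if $Y(a)=s$ implies $Y(b)=s$ for every sequence $b$ obtained from $a$ by interchanging $a_{2k}$ and $a_{2k+1}$ for some or all nonnegative integers $k$. $Y$ is contradictory if there are a real sequence $a$ and real numbers $r\neq s$ such that both $Y(a)=r$ and $Y(a)=s$ hold. *)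

theory Defs
  imports Complex_Main
begin

text \<open>
  \<open>Y a s\<close> reads ``\<open>Y\<close> assigns the value \<open>s\<close> to the sequence \<open>a\<close>''.
  Uniqueness of the assigned value is deliberately not part of the type or of the axioms.
\<close>

definition summation_method :: "((nat \<Rightarrow> real) \<Rightarrow> real \<Rightarrow> bool) \<Rightarrow> bool" where
  "summation_method Y \<longleftrightarrow>
     (\<forall>a s k. Y a s \<longrightarrow> Y (\<lambda>n. k * a n) (k * s)) \<and>
     (\<forall>a b s r. Y a s \<longrightarrow> Y b r \<longrightarrow> Y (\<lambda>n. a n + b n) (s + r)) \<and>
     (\<forall>a s. Y a s \<longleftrightarrow> Y (\<lambda>n. a (Suc n)) (s - a 0))"

text \<open>The terms with indices \<open>2 * k\<close> and \<open>2 * k + 1\<close> are interchanged for exactly the \<open>k \<in> K\<close>.\<close>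

definition swap_pairs :: "nat set \<Rightarrow> (nat \<Rightarrow> 'a) \<Rightarrow> nat \<Rightarrow> 'a" where
  "swap_pairs K a n =
     (if n div 2 \<in> K then (if even n then a (n + 1) else a (n - 1)) else a n)"

definition commutative_method :: "((nat \<Rightarrow> real) \<Rightarrow> real \<Rightarrow> bool) \<Rightarrow> bool" where
  "commutative_method Y \<longleftrightarrow> (\<forall>a s K. Y a s \<longrightarrow> Y (swap_pairs K a) s)"

definition contradictory :: "((nat \<Rightarrow> real) \<Rightarrow> real \<Rightarrow> bool) \<Rightarrow> bool" where
  "contradictory Y \<longleftrightarrow> (\<exists>a r s. r \<noteq> s \<and> Y a r \<and> Y a s)"

end

theory Submission
  imports Defs
begin

text \<open>The negated sequence -1, 1, -1, ... arises from 1, -1, 1, ... in two ways. Commutativity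
  lets it inherit the value s; axiom (C), removing the leading 1, gives it s - 1. So one sequence
  has two distinct values.\<close>

lemma swap_pairs_UNIV_alternating:
  "swap_pairs UNIV (\<lambda>n. (-1) ^ n) = (\<lambda>n. (-1 :: 'a :: ring_1) ^ Suc n)"
proof
  fix n :: nat
  show "swap_pairs UNIV (\<lambda>n. (-1) ^ n) n = (-1 :: 'a) ^ Suc n"
    \<comment> \<open>Odd indices take the term at \<open>n - 1\<close>: the case split resolves
      this subtraction, and the exponents \<open>n - 1\<close> and \<open>Suc n\<close> differ by
      two, so the signs agree.\<close>
    by (cases n) (auto simp: swap_pairs_def)
qed

theorem lemma2:
  fixes Y :: "(nat \<Rightarrow> real) \<Rightarrow> real \<Rightarrow> bool"
  assumes "summation_method Y"
    and "commutative_method Y"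
    and "\<exists>s. Y (\<lambda>n. (-1) ^ n) s"
  shows "contradictory Y"
proof -
  obtain s where s: "Y (\<lambda>n. (-1) ^ n) s"
    using assms(3) by blast
  \<comment> \<open>Swapping every pair and deleting the first term both negate the alternating sequence,
    but only the latter changes the value.\<close>
  have "Y (swap_pairs UNIV (\<lambda>n. (-1) ^ n)) s"
    using assms(2) s unfolding commutative_method_def by blast
  then have swapped: "Y (\<lambda>n. (-1) ^ Suc n) s"
    by (simp only: swap_pairs_UNIV_alternating)
  have "\<And>a s. Y a s \<Longrightarrow> Y (\<lambda>n. a (Suc n)) (s - a 0)"
    using assms(1) unfolding summation_method_def by blast
  from this[OF s] have shifted: "Y (\<lambda>n. (-1) ^ Suc n) (s - 1)"
    by simp
  have "s \<noteq> s - 1"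
    by simp
  with swapped shifted show ?thesis
    unfolding contradictory_def by blast
qed

end
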